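(* Let $p$ be a prime and let $r\geq1$ be an integer. The smallest part of the Jordan partition $\lambda(r,r,p)$ is $r_p$, and it occurs with multiplicity $r_p$. That is, if $\lambda(r,r,p)=(\lambda_1,\dots,\lambda_r)$ with $\lambda_1\geq\cdots\geq\lambda_r>0$, and if $\mu_1>\cdots>\mu_t>0$ are the distinct values among the $\lambda_i$, occurring with positive multiplicities $m_1,\dots,m_t$ respectively, then $\lambda_r=r_p=\mu_t$ and $m_t=r_p$.
   Context: For a nonzero integer $n$, its $p$-part $n_p$ is the largest power of $p$ dividing $n$. Let $F$ be a field of characteristic $p$ and let $J_r(1)$ denote the $r\times r$ Jordan block over $F$ with eigenvalue $1$. For $r,s\geq1$, the Jordan partition $\lambda(r,s,p)=(\lambda_1,\dots,\lambda_b)$, with $\lambda_1\geq\cdots\geq\lambda_b>0$ and $\lambda_1+\cdots+\lambda_b=rs$, is the list of Jordan block sizes of $J_r(1)\otimes J_s(1)$, i.e. $J_r(1)\otimes J_s(1)$ is similar to $J_{\lambda_1}(1)\oplus\cdots\oplus J_{\lambda_b}(1)$; it depends only on $r,s,p$, and it is known that $b=\min(r,s)$. *)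

theory Defs
  imports
    "HOL-Computational_Algebra.Computational_Algebra"
    "Jordan_Normal_Form.Jordan_Normal_Form"
begin

definition p_part :: "nat \<Rightarrow> nat \<Rightarrow> nat" where
  "p_part p n = p ^ multiplicity p n"

text \<open>
  The matrix of the tensor product of two linear maps with respect to the basis
  \<open>e\<^sub>i \<otimes> f\<^sub>j\<close> in lexicographic order.
\<close>

definition kronecker_mat :: "'a :: times mat \<Rightarrow> 'a mat \<Rightarrow> 'a mat" where
  "kronecker_mat A B =
     mat (dim_row A * dim_row B) (dim_col A * dim_col B)
       (\<lambda>(i, j). A $$ (i div dim_row B, j div dim_col B) *
                 B $$ (i mod dim_row B, j mod dim_col B))"

text \<open>
  The list \<open>lam\<close> is the Jordan partition of \<open>r\<close>, \<open>s\<close> over the field \<open>'a\<close>.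
  HOL cannot express that the partition depends on \<open>'a\<close> only through its characteristic
  (this would quantify over types), so the field remains a parameter.
\<close>

definition is_jordan_partition ::
    "'a :: field itself \<Rightarrow> nat \<Rightarrow> nat \<Rightarrow> nat list \<Rightarrow> bool" where
  "is_jordan_partition _ r s lam \<longleftrightarrow>
     sorted_wrt (\<ge>) lam \<and> (\<forall>k \<in> set lam. k > 0) \<and> sum_list lam = r * s \<and>
     similar_mat (kronecker_mat (jordan_block r (1 :: 'a)) (jordan_block s 1))
       (jordan_matrix (map (\<lambda>k. (k, 1)) lam))"

end

theory Submission
  imports Defs "Jordan_Normal_Form.Jordan_Normal_Form_Uniqueness"
begin

text \<open>
  Vectors of the tensor square are functions \<open>f i j\<close> on \<open>[0, r)\<^sup>2\<close>. With the nilpotent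
  shifts \<open>X\<close> and \<open>Y\<close> in the two arguments, the operator \<open>J \<otimes> J - 1 = X (1 + Y) + Y\<close> becomes
  \<open>Y - X\<close> after conjugation with \<open>f i \<mapsto> (- (1 + Y)) ^ i (f i)\<close>. Put \<open>q = r\<^sub>p\<close> and \<open>r = q c\<close>.
  By Frobenius \<open>(Y - X) ^ q = Y ^ q - X ^ q\<close>, so that the kernels of the powers \<open>1\<close>, \<open>q\<close> and
  \<open>q + 1\<close> can be solved explicitly: their dimensions are \<open>r\<close>, \<open>q r\<close> and \<open>q r + r - q\<close>.
  The first two values give \<open>r\<close> blocks, all of size at least \<open>q\<close>, and the third gives \<open>r - q\<close>
  blocks of size greater than \<open>q\<close>.
\<close>

text \<open>Lets kernel dimensions be read off from an explicit linear parametrisation, so that no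
  basis has to be exhibited.\<close>

lemma kernel_dim_eqI:
  fixes A :: "'a :: field mat"
  assumes A: "A \<in> carrier_mat nr nc"
    and bij: "bij_betw T (mat_kernel A) (carrier_vec d)"
    and add: "\<And>v w. v \<in> mat_kernel A \<Longrightarrow> w \<in> mat_kernel A \<Longrightarrow> T (v + w) = T v + T w"
    and smult: "\<And>c v. v \<in> mat_kernel A \<Longrightarrow> T (c \<cdot>\<^sub>v v) = c \<cdot>\<^sub>v T v"
  shows "kernel_dim A = d"
proof -
  interpret k: kernel nr nc A by unfold_locales (rule A)
  interpret W: vec_space "TYPE('a)" d .
  obtain B where B: "finite B" "k.basis B" using kernel_basis_exists[OF A] by auto
  interpret L: linear_map class_ring k.VK W.V T
    by (intro linear_map.intro mod_hom.intro mod_hom_axioms.intro)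
      (use bij add smult in \<open>auto simp: module_hom_def bij_betw_def k.Ker.vectorspace_axioms
        W.vectorspace_axioms k.Ker.module_axioms W.module_axioms\<close>)
  have "k.Ker.fin_dim" using B unfolding k.Ker.fin_dim_def k.Ker.basis_def by auto
  then have "k.dim = W.dim"
    by (rule L.dim_eq) (use bij in \<open>auto simp: bij_betw_def\<close>)
  then show ?thesis by (simp add: W.dim_is_n)
qed

section \<open>The tensor operator conjugated to a difference of shifts\<close>

text \<open>Square arrays are extended by zero to all indices, so that a shift past the border reads
  0 and needs no case distinction.\<close>

definition grid :: "nat \<Rightarrow> (nat \<Rightarrow> nat \<Rightarrow> 'a :: zero) set" where
  "grid r = {f. \<forall>i j. i \<ge> r \<or> j \<ge> r \<longrightarrow> f i j = 0}"

definition shift_diff :: "(nat \<Rightarrow> nat \<Rightarrow> 'a :: ab_group_add) \<Rightarrow> nat \<Rightarrow> nat \<Rightarrow> 'a" where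
  "shift_diff f i j = f i (Suc j) - f (Suc i) j"

definition neg_block :: "(nat \<Rightarrow> 'a :: ab_group_add) \<Rightarrow> nat \<Rightarrow> 'a" where
  "neg_block h j = - (h j + h (Suc j))"

definition twist :: "(nat \<Rightarrow> nat \<Rightarrow> 'a :: ab_group_add) \<Rightarrow> nat \<Rightarrow> nat \<Rightarrow> 'a" where
  "twist f i = (neg_block ^^ i) (f i)"

text \<open>The operator (1 + X)(1 + Y) - 1, with X and Y the shifts of the first and second
  index.\<close>

definition tensor_nilp :: "(nat \<Rightarrow> nat \<Rightarrow> 'a :: ab_group_add) \<Rightarrow> nat \<Rightarrow> nat \<Rightarrow> 'a" where
  "tensor_nilp f i j = f (Suc i) j + f i (Suc j) + f (Suc i) (Suc j)"

lemma funpow_neg_block_add: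
  "(neg_block ^^ n) (\<lambda>j. g j + h j) = (\<lambda>j. (neg_block ^^ n) g j + (neg_block ^^ n) h j)"
  by (induction n) (auto simp: neg_block_def fun_eq_iff)

lemma funpow_neg_block_uminus:
  "(neg_block ^^ n) (\<lambda>j. - h j) = (\<lambda>j. - (neg_block ^^ n) h j)"
  by (induction n) (auto simp: neg_block_def fun_eq_iff)

lemma funpow_neg_block_mult:
  fixes h :: "nat \<Rightarrow> 'a :: ring"
  shows "(neg_block ^^ n) (\<lambda>j. c * h j) = (\<lambda>j. c * (neg_block ^^ n) h j)"
  by (induction n) (auto simp: neg_block_def fun_eq_iff algebra_simps)

lemma funpow_neg_block_Suc:
  "(neg_block ^^ n) (\<lambda>j. h (Suc j)) = (\<lambda>j. (neg_block ^^ n) h (Suc j))"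
  by (induction n) (auto simp: neg_block_def fun_eq_iff)

text \<open>With P = -(1 + Y), row i of \<open>tensor_nilp f\<close> is Y (f i) - P (f (i + 1)). The
  power P^i commutes with Y, and together with the extra P it is the twist of row i + 1, which
  leaves Y - X.\<close>

lemma twist_tensor_nilp: "twist (tensor_nilp f) = shift_diff (twist f)"
proof (intro ext)
  fix i j
  have "tensor_nilp f i = (\<lambda>j. f i (Suc j) + - neg_block (f (Suc i)) j)"
    by (simp add: fun_eq_iff tensor_nilp_def neg_block_def algebra_simps)
  then show "twist (tensor_nilp f) i j = shift_diff (twist f) i j"
    by (simp add: twist_def shift_diff_def funpow_neg_block_add funpow_neg_block_uminus
        funpow_neg_block_Suc funpow_swap1 del: add_uminus_conv_diff)
qed

lemma alternating_telescope:
  fixes h :: "nat \<Rightarrow> 'a :: comm_ring_1"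
  shows "(\<Sum>l<n. (-1)^l * (h (j + l) + h (Suc (j + l)))) = h j - (-1)^n * h (j + n)"
  by (induction n) (auto simp: algebra_simps)

text \<open>Y^r = 0 on these sequences, so 1 + Y is inverted by the finite geometric series in
  -Y.\<close>

lemma bij_betw_neg_block:
  "bij_betw neg_block {h :: nat \<Rightarrow> 'a :: comm_ring_1. \<forall>j\<ge>r. h j = 0} {h. \<forall>j\<ge>r. h j = 0}"
proof (rule bij_betwI[where g = "\<lambda>h j. - (\<Sum>l<r. (-1)^l * h (j + l))"])
  fix h :: "nat \<Rightarrow> 'a" assume h: "h \<in> {h. \<forall>j\<ge>r. h j = 0}"
  have "neg_block (\<lambda>j. - (\<Sum>l<r. (-1)^l * h (j + l))) j = h j" for j
    using alternating_telescope[of h j r] h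
    by (simp add: neg_block_def distrib_left sum.distrib add.commute)
  then show "neg_block (\<lambda>j. - (\<Sum>l<r. (-1)^l * h (j + l))) = h" by blast
  show "(\<lambda>j. - (\<Sum>l<r. (-1)^l * neg_block h (j + l))) = h"
    using alternating_telescope[of h _ r] h
    by (simp add: neg_block_def sum_negf fun_eq_iff del: minus_add_distrib)
qed (auto simp: neg_block_def)

lemma bij_betw_twist: "bij_betw twist (grid r) (grid r :: (nat \<Rightarrow> nat \<Rightarrow> 'a :: comm_ring_1) set)"
proof -
  define W where "W = {h :: nat \<Rightarrow> 'a. \<forall>j\<ge>r. h j = 0}"
  have b: "bij_betw (neg_block ^^ i) W W" for i
    unfolding W_def by (rule bij_betw_funpow[OF bij_betw_neg_block])
  have g: "f \<in> grid r \<longleftrightarrow> (\<forall>i. f i \<in> W) \<and> (\<forall>i\<ge>r. f i = (\<lambda>_. 0))" for f :: "nat \<Rightarrow> nat \<Rightarrow> 'a"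
    unfolding grid_def W_def by (auto simp: fun_eq_iff)
  have z: "(neg_block ^^ i) (\<lambda>_. 0) = (\<lambda>_. 0 :: 'a)" for i
    by (induction i) (auto simp: neg_block_def)
  have W0: "(\<lambda>_. 0) \<in> W" by (simp add: W_def)
  \<comment> \<open>The inverse powers fix the zero row too, so that the inverse map also stays in
    \<open>grid r\<close>.\<close>
  have zi: "inv_into W (neg_block ^^ i) (\<lambda>_. 0) = (\<lambda>_. 0)" for i
    using bij_betw_inv_into_left[OF b[of i] W0] by (simp add: z)
  show ?thesis
  proof (rule bij_betwI[where g = "\<lambda>f i. inv_into W (neg_block ^^ i) (f i)"])
    show "twist \<in> grid r \<rightarrow> (grid r :: (nat \<Rightarrow> nat \<Rightarrow> 'a) set)"
      using bij_betwE[OF b] by (auto simp: g twist_def z)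
    show "(\<lambda>f i. inv_into W (neg_block ^^ i) (f i)) \<in> grid r \<rightarrow> (grid r :: (nat \<Rightarrow> nat \<Rightarrow> 'a) set)"
      using bij_betwE[OF bij_betw_inv_into[OF b]] by (auto simp: g zi)
  qed (auto simp: g twist_def fun_eq_iff bij_betw_inv_into_left[OF b] bij_betw_inv_into_right[OF b])
qed

section \<open>Powers of the shift difference in characteristic p\<close>

text \<open>X and Y commute, so (Y - X)^k is the homogenisation of the polynomial (1 - t)^k. Keeping
  polynomial coefficients instead of binomials lets the Frobenius identity be applied to
  them.\<close>

lemma funpow_shift_diff:
  fixes f :: "nat \<Rightarrow> nat \<Rightarrow> 'a :: comm_ring_1"
  shows "(shift_diff ^^ k) f i j = (\<Sum>l\<le>k. coeff ([:1, -1:] ^ k) l * f (i + l) (j + (k - l)))"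
proof (induction k arbitrary: i j)
  case (Suc k)
  define c where "c = coeff ([:1, -1 :: 'a:] ^ k)"
  have cS: "coeff ([:1, -1 :: 'a:] ^ Suc k) l = c l - (case l of 0 \<Rightarrow> 0 | Suc l' \<Rightarrow> c l')" for l
    by (simp add: c_def coeff_pCons split: nat.split)
  have "degree ([:1, -1 :: 'a:] ^ k) \<le> k"
    using degree_power_le[of "[:1, -1 :: 'a:]" k] by (simp split: if_splits)
  \<comment> \<open>Both sums below are brought to the range up to k + 1: the first by this
    vanishing coefficient, the second by an index shift.\<close>
  then have c0: "c (Suc k) = 0" unfolding c_def by (intro coeff_eq_0) auto
  have "(shift_diff ^^ Suc k) f i j
      = (\<Sum>l\<le>k. c l * f (i + l) (Suc j + (k - l))) - (\<Sum>l\<le>k. c l * f (Suc i + l) (j + (k - l)))"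
    by (simp add: shift_diff_def Suc.IH c_def)
  also have "(\<Sum>l\<le>k. c l * f (i + l) (Suc j + (k - l)))
      = (\<Sum>l\<le>Suc k. c l * f (i + l) (j + (Suc k - l)))"
    by (simp add: c0 Suc_diff_le)
  also have "(\<Sum>l\<le>k. c l * f (Suc i + l) (j + (k - l)))
      = (\<Sum>l\<le>Suc k. (case l of 0 \<Rightarrow> 0 | Suc l' \<Rightarrow> c l') * f (i + l) (j + (Suc k - l)))"
    by (subst sum.atMost_Suc_shift) simp
  finally show ?case
    unfolding cS left_diff_distrib sum_subtractf .
qed simp

lemma funpow_shift_diff_char_power:
  fixes f :: "nat \<Rightarrow> nat \<Rightarrow> 'a :: comm_ring_1"
  assumes "prime CHAR('a)" and q: "q = CHAR('a) ^ a"
  shows "(shift_diff ^^ q) f i j = f i (j + q) - f (i + q) j"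
proof -
  have q0: "q > 0" using assms prime_gt_0_nat by simp
  \<comment> \<open>Frobenius on 1 = (1 - t) + t yields (1 - t)^q = 1 - t^q without evaluating
    (-1)^q.\<close>
  have "([:1, -1 :: 'a:] + monom 1 1) ^ q = [:1, -1:] ^ q + monom 1 1 ^ q"
    by (rule freshmans_dream'[of q a]) (use assms in auto)
  moreover have "[:1, -1 :: 'a:] + monom 1 1 = 1"
    by (simp add: monom_Suc one_pCons)
  ultimately have "[:1, -1 :: 'a:] ^ q = 1 - monom 1 q"
    by (simp add: algebra_simps monom_power)
  then have "(shift_diff ^^ q) f i j
      = (\<Sum>l\<le>q. (if l = 0 then f i (j + q) else 0) - (if l = q then f (i + q) j else 0))"
    unfolding funpow_shift_diff by (intro sum.cong) (use q0 in auto)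
  also have "\<dots> = f i (j + q) - f (i + q) j"
    by (simp add: sum_subtractf)
  finally show ?thesis .
qed

section \<open>Explicit kernels of the powers q and q + 1\<close>

text \<open>The entries of \<open>v\<close> fill rows of length \<open>r\<close> one after the
  other; \<open>d\<close> need not be a multiple of \<open>r\<close>, so the last row may be
  partial.\<close>

definition pad :: "nat \<Rightarrow> nat \<Rightarrow> 'a :: zero vec \<Rightarrow> nat \<Rightarrow> nat \<Rightarrow> 'a" where
  "pad r d v i j = (if j < r \<and> i * r + j < d then v $ (i * r + j) else 0)"

lemma pad_eq_0: "j \<ge> r \<or> i * r + j \<ge> d \<Longrightarrow> pad r d v i j = 0"
  by (auto simp: pad_def)

lemma pad_div_mod: "r > 0 \<Longrightarrow> n < d \<Longrightarrow> pad r d v (n div r) (n mod r) = v $ n"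
  by (simp add: pad_def)

lemma pad_vec:
  "pad r d (vec d (\<lambda>n. f (n div r) (n mod r))) i j = (if j < r \<and> i * r + j < d then f i j else 0)"
  by (simp add: pad_def)

text \<open>By Frobenius the kernel condition reads f (i + q) j = f i (j + q), so the first q rows
  are free and determine the others. The case a = 0 gives the kernel of Y - X itself.\<close>

lemma bij_betw_kernel_coords:
  fixes q r c a :: nat
  assumes p: "prime CHAR('a :: comm_ring_1)" and q: "q = CHAR('a) ^ a" and r: "r = q * c" "r > 0"
  shows "bij_betw (\<lambda>f. vec (q * r) (\<lambda>n. f (n div r) (n mod r)))
    {f \<in> grid r. (shift_diff ^^ q) f = (\<lambda>_ _. 0 :: 'a)} (carrier_vec (q * r))"
proof -
  note D = funpow_shift_diff_char_power[OF p q]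
  have q0: "q > 0" using r by auto
  define ext where "ext v i j = pad r (q * r) v (i mod q) (j + i div q * q)" for v :: "'a vec" and i j
  show ?thesis
  proof (rule bij_betwI[where g = ext])
    show "ext \<in> carrier_vec (q * r) \<rightarrow> {f \<in> grid r. (shift_diff ^^ q) f = (\<lambda>_ _. 0 :: 'a)}"
    proof (intro funcsetI CollectI conjI)
      fix v :: "'a vec"
      \<comment> \<open>Here the divisibility of r by q enters: a row i >= r has been shifted by at
        least c q = r and is zero, so the border imposes nothing on the first q rows.\<close>
      have "r \<le> j + i div q * q" if "i \<ge> r" for i j
      proof -
        have "c \<le> i div q" using that q0 r by (simp add: less_eq_div_iff_mult_less_eq mult.commute)
        then have "c * q \<le> i div q * q" by simp
        then show ?thesis by (simp add: r(1) mult.commute trans_le_add2)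
      qed
      then show "ext v \<in> grid r"
        unfolding grid_def ext_def by (auto intro!: pad_eq_0)
      show "(shift_diff ^^ q) (ext v) = (\<lambda>_ _. 0)"
        using q0 by (simp add: fun_eq_iff D ext_def algebra_simps)
    qed
  next
    fix f :: "nat \<Rightarrow> nat \<Rightarrow> 'a" assume f: "f \<in> {f \<in> grid r. (shift_diff ^^ q) f = (\<lambda>_ _. 0)}"
    have step: "f (i + q) j = f i (j + q)" for i j
      using f D[of f i j] by simp
    have steps: "f (i + m * q) j = f i (j + m * q)" for i j m
    proof (induction m arbitrary: j)
      case (Suc m)
      show ?case using step[of "i + m * q" j] Suc[of "j + q"] by (simp add: algebra_simps)
    qed simp
    have "ext (vec (q * r) (\<lambda>n. f (n div r) (n mod r))) i j = f i j" for i j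
    proof -
      have "i mod q * r + l < q * r" if "l < r" for l
      proof -
        have "Suc (i mod q) * r \<le> q * r" using q0 by (intro mult_right_mono) (auto simp: Suc_le_eq)
        then show ?thesis using that by simp
      qed
      then have "ext (vec (q * r) (\<lambda>n. f (n div r) (n mod r))) i j = f (i mod q) (j + i div q * q)"
        using f unfolding ext_def pad_vec by (auto simp: grid_def)
      also have "\<dots> = f (i mod q + i div q * q) j" by (simp only: steps)
      finally show ?thesis by simp
    qed
    then show "ext (vec (q * r) (\<lambda>n. f (n div r) (n mod r))) = f" by blast
  next
    fix v :: "'a vec" assume v: "v \<in> carrier_vec (q * r)"
    have "ext v (n div r) (n mod r) = v $ n" if "n < q * r" for n
    proof -
      have "n div r < q" using that r by (simp add: less_mult_imp_div_less)
      then show ?thesis using that r(2) by (simp add: ext_def pad_div_mod)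
    qed
    then show "vec (q * r) (\<lambda>n. ext v (n div r) (n mod r)) = v"
      using v by (intro eq_vecI) auto
  qed auto
qed

text \<open>For f in the kernel, (Y^q - X^q) f is killed by Y - X and thus has the form u (i + j).
  Since c is nonzero in the field, u vanishes from r - q on. Its r - q free values, encoded by the
  start of row q, join the q r entries of the first q rows.\<close>

lemma bij_betw_kernel_Suc_coords:
  fixes q r c a d :: nat
  assumes p: "prime CHAR('a :: field)" and q: "q = CHAR('a) ^ a" and r: "r = q * c" "r > 0"
    and c: "\<not> CHAR('a) dvd c" and d: "d = q * r + (r - q)"
  shows "bij_betw (\<lambda>f. vec d (\<lambda>n. f (n div r) (n mod r)))
    {f \<in> grid r. (shift_diff ^^ Suc q) f = (\<lambda>_ _. 0 :: 'a)} (carrier_vec d)"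
proof -
  note D = funpow_shift_diff_char_power[OF p q]
  have q0: "q > 0" using r by auto
  have qr: "q \<le> r" using r by (cases c) auto
  \<comment> \<open>\<open>w v\<close> recovers u from the coordinates, as u s = f 0 (s + q) - f q
    s.\<close>
  define w where "w v s = pad r d v 0 (s + q) - pad r d v q s" for v :: "'a vec" and s
  \<comment> \<open>Iterating f (i + q) j = f i (j + q) - u (i + j) subtracts the same value of u at
    every step, hence the factor \<open>i div q\<close>. When it is 0, it also makes the truncated
    subtraction harmless.\<close>
  define ext where "ext v i j =
      pad r d v (i mod q) (j + i div q * q) - of_nat (i div q) * w v (i mod q + j + (i div q - 1) * q)"
    for v :: "'a vec" and i j
  have w0: "w v s = 0" if "s \<ge> r - q" for v s
  proof -
    \<comment> \<open>Column s + q >= r lies outside row 0, and position q r + s lies beyond the d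
      stored entries.\<close>
    have "pad r d v 0 (s + q) = 0" "pad r d v q s = 0"
      using that qr by (auto simp: d intro!: pad_eq_0)
    then show ?thesis by (simp add: w_def)
  qed
  \<comment> \<open>Both terms of the difference carry the same value of \<open>w v\<close>, with
    factors \<open>i div q\<close> and \<open>i div q + 1\<close>, so one copy survives.\<close>
  have Dext: "(shift_diff ^^ q) (ext v) i j = w v (i + j)" for v i j
  proof -
    have *: "i mod q + j + i div q * q = i + j"
      using mod_div_mult_eq[of i q] by linarith
    have "of_nat (i div q) * w v (i mod q + (j + q) + (i div q - 1) * q) = of_nat (i div q) * w v (i + j)"
    proof (cases "i div q")
      case (Suc m)
      then have "i mod q + (j + q) + (i div q - 1) * q = i + j" using * by simp
      then show ?thesis by (simp only:)
    qed simp
    then have "ext v i (j + q) = pad r d v (i mod q) (j + q + i div q * q) - of_nat (i div q) * w v (i + j)"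
      by (simp only: ext_def)
    moreover have "ext v (i + q) j = pad r d v (i mod q) (j + q + i div q * q) - (of_nat (i div q) + 1) * w v (i + j)"
    proof -
      have "i mod q + j + ((i + q) div q - 1) * q = i + j" using q0 * by simp
      then have "ext v (i + q) j = pad r d v (i mod q) (j + (i + q) div q * q)
          - of_nat ((i + q) div q) * w v (i + j)"
        by (simp only: ext_def mod_add_self2)
      then show ?thesis using q0 by (simp add: algebra_simps)
    qed
    ultimately show ?thesis
      by (simp only: D) (simp add: algebra_simps)
  qed
  show ?thesis
  proof (rule bij_betwI[where g = ext])
    show "ext \<in> carrier_vec d \<rightarrow> {f \<in> grid r. (shift_diff ^^ Suc q) f = (\<lambda>_ _. 0 :: 'a)}"
    proof (intro funcsetI CollectI conjI)
      fix v :: "'a vec"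
      \<comment> \<open>This single bound covers both border cases, j >= r and i >= r.\<close>
      have large: "ext v i j = 0" if "j + i div q * q \<ge> r" for i j
      proof (cases "i div q")
        case 0
        then show ?thesis using that by (simp add: ext_def pad_eq_0)
      next
        case (Suc m)
        then have "r - q \<le> i mod q + j + (i div q - 1) * q" using that by auto
        then show ?thesis using that by (simp add: ext_def pad_eq_0 w0)
      qed
      have "r \<le> j + i div q * q" if "i \<ge> r" for i j
      proof -
        have "c \<le> i div q" using that q0 r by (simp add: less_eq_div_iff_mult_less_eq mult.commute)
        then have "c * q \<le> i div q * q" by simp
        then show ?thesis by (simp add: r(1) mult.commute trans_le_add2)
      qed
      then show "ext v \<in> grid r"
        unfolding grid_def by (auto intro!: large)
      show "(shift_diff ^^ Suc q) (ext v) = (\<lambda>_ _. 0)"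
        by (simp add: fun_eq_iff shift_diff_def Dext)
    qed
  next
    fix f :: "nat \<Rightarrow> nat \<Rightarrow> 'a" assume f: "f \<in> {f \<in> grid r. (shift_diff ^^ Suc q) f = (\<lambda>_ _. 0)}"
    then have f0: "f i j = 0" if "i \<ge> r \<or> j \<ge> r" for i j using that by (auto simp: grid_def)
    define h where "h = (shift_diff ^^ q) f"
    define u where "u = h 0"
    \<comment> \<open>Annihilation by Y - X makes h constant along antidiagonals.\<close>
    have hS: "h (Suc i) j = h i (Suc j)" for i j
      using f by (simp add: h_def shift_diff_def fun_eq_iff)
    have h: "h i j = u (i + j)" for i j
      by (induction i arbitrary: j) (simp_all add: u_def hS)
    have u: "u s = f 0 (s + q) - f q s" for s
      by (simp add: u_def h_def D)
    have step: "f (i + q) j = f i (j + q) - u (i + j)" for i j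
      using D[of f i j] h[of i j] unfolding h_def by (simp add: eq_diff_eq diff_eq_eq add.commute)
    have steps: "f (i + m * q) j = f i (j + m * q) - of_nat m * u (i + j + (m - 1) * q)" for i j m
    proof (induction m arbitrary: j)
      case (Suc m)
      have "of_nat m * u (i + (j + q) + (m - 1) * q) = of_nat m * u (i + j + m * q)"
        by (cases m) (simp_all add: algebra_simps)
      then have "f (i + m * q) (j + q) = f i (j + q + m * q) - of_nat m * u (i + j + m * q)"
        using Suc[of "j + q"] by (simp only:)
      moreover have "f (i + Suc m * q) j = f (i + m * q) (j + q) - u (i + j + m * q)"
        using step[of "i + m * q" j] by (simp add: add_ac)
      ultimately show ?case by (simp only:) (simp add: algebra_simps)
    qed simp
    \<comment> \<open>The c steps from row 0 to row r = c q relate two entries outside the square,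
      both 0. What remains is c u s = 0, and p does not divide c.\<close>
    have u0: "u s = 0" if "s \<ge> r - q" for s
    proof -
      have "r - q = (c - 1) * q" by (cases c) (simp_all add: r(1) mult.commute)
      then obtain j where j: "j + (c - 1) * q = s"
        using \<open>s \<ge> r - q\<close> le_add_diff_inverse2[of "r - q" s] by metis
      have "of_nat c * u s = 0"
        using steps[of 0 c j] j f0[of r j] f0[of 0 "j + r"] by (simp add: r(1) mult.commute)
      moreover have "of_nat c \<noteq> (0 :: 'a)" using c by (simp add: of_nat_eq_0_iff_char_dvd)
      ultimately show ?thesis by simp
    qed
    define v where "v = vec d (\<lambda>n. f (n div r) (n mod r))"
    have pad: "pad r d v i l = f i l" if "i < q" for i l
    proof -
      have "i * r + l < q * r" if "l < r"
      proof -
        have "Suc i * r \<le> q * r" using \<open>i < q\<close> by (intro mult_right_mono) auto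
        then show ?thesis using that by simp
      qed
      then show ?thesis by (cases "l < r") (simp_all add: v_def pad_vec d f0 trans_less_add1)
    qed
    have w: "w v s = u s" for s
    \<comment> \<open>Below r - q the entry of row q is among the stored ones; from r - q on both
      sides vanish.\<close>
    proof (cases "s < r - q")
      case True
      then have "pad r d v q s = f q s" by (auto simp: v_def pad_vec d)
      then show ?thesis using q0 by (simp add: w_def u pad)
    qed (simp add: w0 u0)
    have "ext v i j = f i j" for i j
      using steps[of "i mod q" "i div q" j] q0 by (simp add: ext_def w pad)
    then show "ext (vec d (\<lambda>n. f (n div r) (n mod r))) = f" unfolding v_def by blast
  next
    fix v :: "'a vec" assume v: "v \<in> carrier_vec d"
    have "ext v (n div r) (n mod r) = v $ n" if n: "n < d" for n
    proof -
      \<comment> \<open>As d < (q + 1) r, only row q can occur besides the first q rows.\<close>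
      have nq: "n div r = q" if "\<not> n div r < q"
      proof -
        have "n < Suc q * r" using n qr q0 r by (auto simp: d)
        then have "n div r < Suc q" by (rule less_mult_imp_div_less)
        then show ?thesis using that by simp
      qed
      show ?thesis
      proof (cases "n div r < q")
        case True
        then show ?thesis using n r(2) by (simp add: ext_def pad_div_mod)
      next
        case False
        then have "n div r = q" by (rule nq)
        \<comment> \<open>In row q the correction has factor 1, and the two copies of the entry from
          row 0 cancel.\<close>
        then show ?thesis using pad_div_mod[OF r(2) n, of v] q0 by (simp add: ext_def w_def)
      qed
    qed
    then show "vec d (\<lambda>n. ext v (n div r) (n mod r)) = v"
      using v by (intro eq_vecI) auto
  qed auto
qed

section \<open>From matrices to arrays\<close>

text \<open>Row-major indexing matches the lexicographic basis order of
  \<open>kronecker_mat\<close>.\<close>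

definition vec_grid :: "nat \<Rightarrow> 'a :: zero vec \<Rightarrow> nat \<Rightarrow> nat \<Rightarrow> 'a" where
  "vec_grid r v i j = (if i < r \<and> j < r then v $ (i * r + j) else 0)"

lemma mult_add_less_square: "i < r \<Longrightarrow> j < r \<Longrightarrow> i * r + j < r * (r :: nat)"
proof -
  assume "i < r" "j < r"
  then have "Suc i * r \<le> r * r" by (intro mult_right_mono) auto
  then show ?thesis using \<open>j < r\<close> by simp
qed

lemma bij_betw_vec_grid: "bij_betw (vec_grid r) (carrier_vec (r * r)) (grid r)"
proof (rule bij_betwI[where g = "\<lambda>f. vec (r * r) (\<lambda>n. f (n div r) (n mod r))"])
  fix v :: "'a vec" assume v: "v \<in> carrier_vec (r * r)"
  have "n div r < r \<and> n mod r < r" if "n < r * r" for n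
    using that by (cases "r = 0") (auto simp: less_mult_imp_div_less)
  then show "vec (r * r) (\<lambda>n. vec_grid r v (n div r) (n mod r)) = v"
    using v by (intro eq_vecI) (auto simp: vec_grid_def)
qed (auto simp: grid_def vec_grid_def fun_eq_iff mult_add_less_square)

text \<open>Since \<open>g\<close> vanishes at \<open>r\<close>, the last row, which has no
  superdiagonal entry, obeys the same formula.\<close>

lemma sum_jordan_row:
  fixes g :: "nat \<Rightarrow> 'a :: comm_ring_1"
  assumes "i < r" "\<And>a. a \<ge> r \<Longrightarrow> g a = 0"
  shows "(\<Sum>a<r. jordan_block r 1 $$ (i, a) * g a) = g i + g (Suc i)"
proof -
  have "(\<Sum>a<r. jordan_block r 1 $$ (i, a) * g a)
      = (\<Sum>a<r. (if i = a then g a else 0) + (if Suc i = a then g a else 0))"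
    using assms(1) by (intro sum.cong) auto
  also have "\<dots> = g i + g (Suc i)"
    using assms by (auto simp: sum.distrib not_less)
  finally show ?thesis .
qed

lemma sum_lessThan_mult:
  fixes g :: "nat \<Rightarrow> 'a :: comm_monoid_add"
  shows "(\<Sum>k<m * n. g k) = (\<Sum>a<m. \<Sum>b<n. g (a * n + b))"
proof -
  have "sum g {a * n..<a * n + n} = (\<Sum>b<n. g (a * n + b))" for a
    using sum.shift_bounds_nat_ivl[of g 0 "a * n" n] by (simp add: atLeast0LessThan add.commute)
  then show ?thesis by (simp flip: sum.nat_group)
qed

text \<open>The sum over the Kronecker product splits into nested sums over the two indices, and
  each of them acts as 1 + shift.\<close>

lemma vec_grid_char_matrix_kronecker:
  fixes v :: "'a :: field vec"
  assumes v: "v \<in> carrier_vec (r * r)"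
  shows "vec_grid r (char_matrix (kronecker_mat (jordan_block r 1) (jordan_block r 1)) 1 *\<^sub>v v)
    = tensor_nilp (vec_grid r v)"
proof (intro ext)
  fix i j
  define K :: "'a mat" where "K = kronecker_mat (jordan_block r 1) (jordan_block r 1)"
  let ?J = "jordan_block r (1 :: 'a)" and ?f = "vec_grid r v"
  have K: "K \<in> carrier_mat (r * r) (r * r)" by (simp add: K_def kronecker_mat_def)
  show "vec_grid r (char_matrix (kronecker_mat ?J ?J) 1 *\<^sub>v v) i j = tensor_nilp ?f i j"
  proof (cases "i < r \<and> j < r")
    case True
    then have ij: "i * r + j < r * r" by (simp add: mult_add_less_square)
    have "(K *\<^sub>v v) $ (i * r + j) = (\<Sum>k<r * r. K $$ (i * r + j, k) * v $ k)"
      using K v ij by (auto simp: scalar_prod_def atLeast0LessThan intro!: sum.cong)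
    also have "\<dots> = (\<Sum>a<r. \<Sum>b<r. K $$ (i * r + j, a * r + b) * v $ (a * r + b))"
      by (rule sum_lessThan_mult)
    also have "\<dots> = (\<Sum>a<r. ?J $$ (i, a) * (\<Sum>b<r. ?J $$ (j, b) * ?f a b))"
      unfolding sum_distrib_left
      using True ij mult_add_less_square
      by (intro sum.cong refl) (auto simp: K_def kronecker_mat_def vec_grid_def)
    also have "\<dots> = (\<Sum>a<r. ?J $$ (i, a) * (?f a j + ?f a (Suc j)))"
    proof -
      have "(\<Sum>b<r. ?J $$ (j, b) * ?f a b) = ?f a j + ?f a (Suc j)" for a
        using True by (intro sum_jordan_row) (auto simp: vec_grid_def)
      then show ?thesis by simp
    qed
    also have "\<dots> = ?f i j + ?f i (Suc j) + (?f (Suc i) j + ?f (Suc i) (Suc j))"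
      using True by (subst sum_jordan_row) (auto simp: vec_grid_def)
    finally have "(K *\<^sub>v v) $ (i * r + j) = \<dots>" .
    moreover have "char_matrix K 1 *\<^sub>v v = K *\<^sub>v v + (-1) \<cdot>\<^sub>v v"
      using K v unfolding char_matrix_def
      by (subst add_mult_distrib_mat_vec[where nr = "r * r" and nc = "r * r"]) auto
    ultimately have "(char_matrix K 1 *\<^sub>v v) $ (i * r + j)
        = ?f i j + ?f i (Suc j) + (?f (Suc i) j + ?f (Suc i) (Suc j)) - ?f i j"
      using True K v ij by (simp add: vec_grid_def)
    then show ?thesis
      using True unfolding K_def by (simp add: vec_grid_def[of r "_ *\<^sub>v _"] tensor_nilp_def)
  qed (auto simp: vec_grid_def tensor_nilp_def)
qed

text \<open>\<open>twist\<close> after \<open>vec_grid\<close> is a linear bijection that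
  intertwines the matrix minus 1 with \<open>shift_diff\<close>. Kernels of k-th powers therefore
  correspond, and the assumed coordinates give their dimension.\<close>

lemma dim_gen_eigenspace_kronecker:
  assumes "bij_betw (\<lambda>f. vec d (\<lambda>n. f (n div r) (n mod r)))
    {f \<in> grid r. (shift_diff ^^ k) f = (\<lambda>_ _. 0 :: 'a :: field)} (carrier_vec d)"
  shows "dim_gen_eigenspace (kronecker_mat (jordan_block r (1 :: 'a)) (jordan_block r 1)) 1 k = d"
proof -
  define A :: "'a mat" where "A = char_matrix (kronecker_mat (jordan_block r 1) (jordan_block r 1)) 1"
  have A: "A \<in> carrier_mat (r * r) (r * r)" by (simp add: A_def kronecker_mat_def)
  then have Ak: "A ^\<^sub>m k \<in> carrier_mat (r * r) (r * r)" for k by simp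
  define T :: "'a vec \<Rightarrow> nat \<Rightarrow> nat \<Rightarrow> 'a" where "T = twist \<circ> vec_grid r"
  have bijT: "bij_betw T (carrier_vec (r * r)) (grid r)"
    unfolding T_def by (rule bij_betw_trans[OF bij_betw_vec_grid bij_betw_twist])
  have TA: "T (A *\<^sub>v v) = shift_diff (T v)" if "v \<in> carrier_vec (r * r)" for v
    using vec_grid_char_matrix_kronecker[OF that] by (simp add: T_def A_def twist_tensor_nilp)
  have TAk: "T (A ^\<^sub>m k *\<^sub>v v) = (shift_diff ^^ k) (T v)" if "v \<in> carrier_vec (r * r)" for v
    using that
  proof (induction k arbitrary: v)
    case (Suc k)
    then have "A ^\<^sub>m Suc k *\<^sub>v v = A ^\<^sub>m k *\<^sub>v (A *\<^sub>v v)"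
      using A Ak by (simp add: assoc_mult_mat_vec[of _ "r * r" "r * r"])
    then show ?case
      using Suc A by (simp add: TA funpow_swap1)
  qed (use A in simp)
  have Tadd: "T (v + w) = (\<lambda>i j. T v i j + T w i j)"
    if "v \<in> carrier_vec (r * r)" "w \<in> carrier_vec (r * r)" for v w
  proof -
    have "vec_grid r (v + w) i = (\<lambda>j. vec_grid r v i j + vec_grid r w i j)" for i
      using that by (auto simp: vec_grid_def fun_eq_iff mult_add_less_square)
    then show ?thesis by (intro ext) (simp add: T_def twist_def funpow_neg_block_add)
  qed
  have Tsmult: "T (c \<cdot>\<^sub>v v) = (\<lambda>i j. c * T v i j)" if "v \<in> carrier_vec (r * r)" for c v
  proof -
    have "vec_grid r (c \<cdot>\<^sub>v v) i = (\<lambda>j. c * vec_grid r v i j)" for i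
      using that by (auto simp: vec_grid_def fun_eq_iff mult_add_less_square)
    then show ?thesis by (intro ext) (simp add: T_def twist_def funpow_neg_block_mult)
  qed
  have T0: "T (0\<^sub>v (r * r)) = (\<lambda>_ _. 0)"
  proof -
    have "(0 :: 'a) \<cdot>\<^sub>v 0\<^sub>v (r * r) = 0\<^sub>v (r * r)" by (intro eq_vecI) auto
    then show ?thesis using Tsmult[of "0\<^sub>v (r * r)" 0] by simp
  qed
  have "(A ^\<^sub>m k *\<^sub>v v = 0\<^sub>v (r * r)) \<longleftrightarrow> (shift_diff ^^ k) (T v) = (\<lambda>_ _. 0)"
    if "v \<in> carrier_vec (r * r)" for v
    using inj_on_eq_iff[OF bij_betw_imp_inj_on[OF bijT], of "A ^\<^sub>m k *\<^sub>v v" "0\<^sub>v (r * r)"] that Ak[of k]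
    by (simp add: TAk T0)
  then have ker: "mat_kernel (A ^\<^sub>m k)
      = {v \<in> carrier_vec (r * r). T v \<in> {f \<in> grid r. (shift_diff ^^ k) f = (\<lambda>_ _. 0)}}"
    using bij_betwE[OF bijT] unfolding mat_kernel[OF Ak] by auto
  have sub: "bij_betw T {v \<in> carrier_vec (r * r). T v \<in> S} S" if "S \<subseteq> grid r" for S
  proof (rule bij_betw_subset[OF bijT])
    have "S \<subseteq> T ` carrier_vec (r * r)"
      using that bij_betw_imp_surj_on[OF bijT] by simp
    then show "T ` {v \<in> carrier_vec (r * r). T v \<in> S} = S" by blast
  qed auto
  have "bij_betw T (mat_kernel (A ^\<^sub>m k)) {f \<in> grid r. (shift_diff ^^ k) f = (\<lambda>_ _. 0)}"
    unfolding ker by (rule sub) auto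
  then have bij: "bij_betw (\<lambda>v. vec d (\<lambda>n. T v (n div r) (n mod r))) (mat_kernel (A ^\<^sub>m k)) (carrier_vec d)"
    using bij_betw_trans[OF _ assms] by (simp add: comp_def)
  have "kernel_dim (A ^\<^sub>m k) = d"
  proof (rule kernel_dim_eqI[OF Ak bij])
  qed (use mat_kernel_carrier[OF Ak] in \<open>auto simp: Tadd Tsmult subset_iff intro!: eq_vecI\<close>)
  then show ?thesis by (simp add: dim_gen_eigenspace_def A_def)
qed

section \<open>Block sizes from the kernel dimensions\<close>

text \<open>Every term is at most q, so the maximal total forces each of them to be q.\<close>

lemma sum_list_min_eq:
  fixes lam :: "nat list"
  assumes "sum_list (map (min q) lam) = q * length lam"
  shows "\<forall>x \<in> set lam. q \<le> x"
  using assms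
proof (induction lam)
  case (Cons x lam)
  have "sum_list (map (min q) lam) \<le> q * length lam"
    using sum_list_mono[of lam "min q" "\<lambda>_. q"] by (simp add: sum_list_triv mult.commute)
  moreover have "min q x + sum_list (map (min q) lam) = q + q * length lam" "min q x \<le> q"
    using Cons.prems by simp_all
  ultimately have "min q x = q" "sum_list (map (min q) lam) = q * length lam"
    by linarith+
  then show ?case using Cons.IH by simp
qed simp

text \<open>Each part contributes q + 1, except that a part equal to q falls short by 1.\<close>

lemma sum_list_min_Suc:
  fixes lam :: "nat list"
  assumes "\<forall>x \<in> set lam. q \<le> x"
  shows "sum_list (map (min (Suc q)) lam) + count_list lam q = Suc q * length lam"
  using assms by (induction lam) (auto simp: min_def)

lemma last_eq_Min:
  fixes xs :: "'a :: linorder list"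
  assumes "sorted_wrt (\<ge>) xs" "xs \<noteq> []"
  shows "last xs = Min (set xs)"
proof (rule Min_eqI[symmetric])
  fix y assume "y \<in> set xs"
  moreover have "sorted_wrt (\<ge>) (butlast xs @ [last xs])" using assms by simp
  moreover have "set xs = set (butlast xs @ [last xs])" using assms by simp
  ultimately show "last xs \<le> y" by (auto simp del: append_butlast_last_id simp: sorted_wrt_append)
qed (use assms in auto)

theorem theorem13:
  fixes p r :: nat and lam mu m :: "nat list"
  assumes "prime p" and "r \<ge> 1" and "CHAR('a :: field) = p"
    and "is_jordan_partition TYPE('a) r r lam"
    and "sorted_wrt (>) mu" and "set mu = set lam"
    and "m = map (count_list lam) mu"
  shows "length lam = r \<and>
         Min (set lam) = p_part p r \<and> count_list lam (p_part p r) = p_part p r \<and>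
         lam ! (r - 1) = p_part p r \<and> last mu = p_part p r \<and> last m = p_part p r"
proof -
  let ?K = "kronecker_mat (jordan_block r (1 :: 'a)) (jordan_block r 1)"
  define q where "q = p_part p r"
  have p: "prime CHAR('a)" and q: "q = CHAR('a) ^ multiplicity p r"
    using assms by (auto simp: q_def p_part_def)
  have "r \<noteq> 0" "\<not> is_unit p" using assms by auto
  then obtain c where r: "r = q * c" and c: "\<not> p dvd c"
    unfolding q_def p_part_def by (rule multiplicity_decompose')
  have r0: "r > 0" using assms by simp
  then have q0: "q > 0" "q \<le> r" using r by (auto intro: dvd_imp_le)
  have sorted: "sorted_wrt (\<ge>) lam" and pos: "\<forall>k \<in> set lam. k > 0"
    and sim: "similar_mat ?K (jordan_matrix (map (\<lambda>k. (k, 1)) lam))"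
    using assms by (auto simp: is_jordan_partition_def)
  have filter: "map fst [(n, e)\<leftarrow>map (\<lambda>k. (k, 1 :: 'a)) xs. e = 1] = xs" for xs :: "nat list"
    by (induction xs) auto
  \<comment> \<open>A block of size x contributes \<open>min k x\<close> to the k-th generalized
    eigenspace, so three kernel dimensions supply all that is needed about
    \<open>lam\<close>.\<close>
  have dims: "sum_list (map (min k) lam) = dim_gen_eigenspace ?K 1 k" for k
    by (simp only: dim_gen_eigenspace_similar[OF sim] dim_gen_eigenspace_jordan_matrix filter)
  have "sum_list (map (min 1) lam) = (\<Sum>x\<leftarrow>lam. 1)"
    using pos by (intro arg_cong[of _ _ sum_list] map_cong) auto
  then have "length lam = sum_list (map (min 1) lam)"
    by (simp add: sum_list_triv)
  \<comment> \<open>The instance with exponent 0, that is q = 1 and c = r, gives the kernel of Y -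
    X.\<close>
  also have "\<dots> = 1 * r"
    unfolding dims
    by (rule dim_gen_eigenspace_kronecker bij_betw_kernel_coords[OF p, of _ 0 _ r])+ (use r0 in auto)
  finally have len: "length lam = r" by simp
  have "sum_list (map (min q) lam) = q * r"
    unfolding dims
    by (rule dim_gen_eigenspace_kronecker bij_betw_kernel_coords[OF p q r r0])+
  then have ge: "\<forall>x \<in> set lam. q \<le> x"
    by (intro sum_list_min_eq) (simp add: len)
  have "sum_list (map (min (Suc q)) lam) = q * r + (r - q)"
    unfolding dims
    by (rule dim_gen_eigenspace_kronecker bij_betw_kernel_Suc_coords[OF p q r r0 _ refl])+
      (use c assms in simp)
  \<comment> \<open>As q <= r, the total q r + (r - q) falls short of (q + 1) r by exactly
    q.\<close>
  then have count: "count_list lam q = q"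
    using sum_list_min_Suc[OF ge] q0 by (simp add: len)
  then have qin: "q \<in> set lam"
    using q0 by (metis count_list_0_iff less_irrefl)
  then have Min: "Min (set lam) = q"
    using ge by (intro Min_eqI) auto
  have ne: "lam \<noteq> []" "mu \<noteq> []" using qin assms(6) by auto
  have "lam ! (r - 1) = q"
    using last_eq_Min[OF sorted ne(1)] ne Min by (simp add: last_conv_nth len)
  moreover have "sorted_wrt (\<ge>) mu"
    by (rule sorted_wrt_mono_rel[OF _ assms(5)]) auto
  then have "last mu = q"
    using last_eq_Min[of mu] ne Min assms(6) by simp
  ultimately show ?thesis
    using len Min count ne assms(7) by (simp add: q_def last_map)
qed

end
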